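(* Let $p$ be a prime and $n\geq 2$ an integer, and for $c\in\mathbb{F}_p$ let $h_c:\mathbb{F}_p\to\mathbb{F}_p$, $h_c(x)=x^n+c$. Let $a\in\mathbb{F}_p$. The diagonal line $j=i+a$ is a desert line in $\mathrm{PPD}(h_c,p)$ if and only if $a$ is an $n$-power non-residue modulo $p$. Hence there are exactly $$p-1-\frac{p-1}{\gcd(n,p-1)}$$ desert lines in $\mathrm{PPD}(h_c,p)$. Moreover, if $a$ is an $n$-power residue, then there are exactly $\gcd(p-1,n)$ fixed points on the line $j=i+a$. For $a=0$ there is exactly one fixed point on the line $j=i$ (namely at $i=0$).
   Context: All arithmetic is in the prime field $\mathbb{F}_p$, and $\mathbb{F}_p^*$ is its multiplicative group. For a map $h$, $h^r$ denotes its $r$-fold composition. A point $x\in\mathbb{F}_p$ is a periodic point of $h_c$ if $h_c^r(x)=x$ for some $r\geq 1$; it is a fixed point if $h_c(x)=x$. The periodic point diagram $\mathrm{PPD}(h_c,p)$ of the family $(h_c)_{c\in\mathbb{F}_p}$ is the set of marked positions $(i,j)\in\mathbb{F}_p\times\mathbb{F}_p$ such that $j$ is a periodic point of $h_i$ (the first coordinate is the parameter $c=i$, the second coordinate is the point $x=j$). For $a\in\mathbb{F}_p$, the diagonal line $j=i+a$ is the set of all positions $(i,i+a)$, $i\in\mathbb{F}_p$. A desert line is a diagonal line containing no periodic points, i.e. such that for every $i\in\mathbb{F}_p$ the point $i+a$ is not a periodic point of $h_i$. A fixed point on the line $j=i+a$ is a position $(i,i+a)$ with $h_i(i+a)=i+a$.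 An element $a\in\mathbb{F}_p^*$ (so $a\neq 0$) is an $n$-power residue if $x^n=a$ has a solution in $\mathbb{F}_p$, and an $n$-power non-residue otherwise. *)

theory Defs
  imports "HOL-Number_Theory.Residues"
begin

abbreviation Fp :: "nat \<Rightarrow> int ring" where
  "Fp p \<equiv> residue_ring (int p)"

definition h :: "nat \<Rightarrow> nat \<Rightarrow> int \<Rightarrow> int \<Rightarrow> int" where
  "h p n c x = x [^]\<^bsub>Fp p\<^esub> n \<oplus>\<^bsub>Fp p\<^esub> c"

definition periodic_point :: "nat \<Rightarrow> (int \<Rightarrow> int) \<Rightarrow> int \<Rightarrow> bool" where
  "periodic_point p f x \<longleftrightarrow> x \<in> carrier (Fp p) \<and> (\<exists>r\<ge>1. (f ^^ r) x = x)"

definition fixed_point :: "nat \<Rightarrow> (int \<Rightarrow> int) \<Rightarrow> int \<Rightarrow> bool" where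
  "fixed_point p f x \<longleftrightarrow> x \<in> carrier (Fp p) \<and> f x = x"

text \<open>The family of maps is passed as \<open>H\<close>, with \<open>H c\<close> the map of parameter \<open>c\<close>.\<close>

definition PPD :: "nat \<Rightarrow> (int \<Rightarrow> int \<Rightarrow> int) \<Rightarrow> (int \<times> int) set" where
  "PPD p H = {(i, j). i \<in> carrier (Fp p) \<and> j \<in> carrier (Fp p) \<and> periodic_point p (H i) j}"

definition diagonal_line :: "nat \<Rightarrow> int \<Rightarrow> (int \<times> int) set" where
  "diagonal_line p a = {(i, i \<oplus>\<^bsub>Fp p\<^esub> a) | i. i \<in> carrier (Fp p)}"

text \<open>Lines are sets of positions, so that counting desert lines counts lines rather than
  offsets \<open>a\<close>.\<close>

definition desert_line :: "nat \<Rightarrow> (int \<Rightarrow> int \<Rightarrow> int) \<Rightarrow> (int \<times> int) set \<Rightarrow> bool" where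
  "desert_line p H L \<longleftrightarrow> (\<exists>a\<in>carrier (Fp p). L = diagonal_line p a) \<and> L \<inter> PPD p H = {}"

definition fixed_points_on :: "nat \<Rightarrow> (int \<Rightarrow> int \<Rightarrow> int) \<Rightarrow> (int \<times> int) set \<Rightarrow> (int \<times> int) set" where
  "fixed_points_on p H L = {(i, j) \<in> L. fixed_point p (H i) j}"

text \<open>Both notions are restricted to nonzero elements; \<open>0\<close> is neither a residue nor a
  non-residue.\<close>

definition power_residue :: "nat \<Rightarrow> nat \<Rightarrow> int \<Rightarrow> bool" where
  "power_residue p n a \<longleftrightarrow>
     a \<in> carrier (Fp p) - {\<zero>\<^bsub>Fp p\<^esub>} \<and> (\<exists>x\<in>carrier (Fp p). x [^]\<^bsub>Fp p\<^esub> n = a)"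

definition power_nonresidue :: "nat \<Rightarrow> nat \<Rightarrow> int \<Rightarrow> bool" where
  "power_nonresidue p n a \<longleftrightarrow>
     a \<in> carrier (Fp p) - {\<zero>\<^bsub>Fp p\<^esub>} \<and> \<not> (\<exists>x\<in>carrier (Fp p). x [^]\<^bsub>Fp p\<^esub> n = a)"

end

theory Submission
  imports Defs
begin

text \<open>
  On the line \<open>j = i + a\<close> the equation \<open>h\<^sub>i j = j\<close> reads \<open>j\<^sup>n + i = i + a\<close>, that is,
  \<open>j\<^sup>n = a\<close>. So the fixed points on the line correspond to the \<open>n\<close>-th roots of \<open>a\<close>
  (\<open>fixed_points_on_diagonal\<close>). Conversely, a periodic point has a preimage: if \<open>i + a\<close> is
  periodic for \<open>h\<^sub>i\<close>, then \<open>i + a = y\<^sup>n + i\<close> for some \<open>y\<close>, so \<open>a\<close> is an \<open>n\<close>-th power.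
  Hence a line with any periodic point already has a fixed point, and it is a desert line
  exactly if \<open>a\<close> has no \<open>n\<close>-th root (\<open>diagonal_meets_PPD_iff\<close>). Since \<open>0\<close> is its own
  \<open>n\<close>-th power, these \<open>a\<close> are the non-residues.

  The two counts are facts about the power map \<open>x \<mapsto> x\<^sup>n\<close> on the multiplicative group, which
  is cyclic of order \<open>p - 1\<close>. Its kernel has \<open>gcd n (p - 1)\<close> elements, every nonempty fibre
  is a translate of the kernel, and so the image has \<open>(p - 1) / gcd n (p - 1)\<close> elements.
\<close>

section \<open>The power map on a finite cyclic group\<close>

text \<open>With \<open>d = gcd n N\<close> for the order \<open>N\<close> and a generator \<open>g\<close>, the condition
  \<open>(g\<^sup>i)\<^sup>n = \<one>\<close> says \<open>N dvd i * n\<close>. As \<open>n div d\<close> and \<open>N div d\<close> are coprime, this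
  means that \<open>i\<close> is one of the \<open>d\<close> multiples of \<open>N div d\<close> below \<open>N\<close>.\<close>

lemma (in group) card_roots_of_one_cyclic:
  assumes fin: "finite (carrier G)" and g: "g \<in> carrier G"
    and gen: "carrier G = {g [^] i | i :: nat. i \<in> UNIV}"
  shows "card {x \<in> carrier G. x [^] (n::nat) = \<one>} = gcd n (order G)"
proof -
  define N where "N = order G"
  define d where "d = gcd n N"
  have ordN: "ord g = N"
    using generate_pow_card[OF g] generate_pow_nat[OF g] ord_ge_1[OF fin g] gen
    by (auto simp: N_def order_def)
  have N: "N > 0"
    using ord_ge_1[OF fin g] ordN by simp
  have d: "d > 0" "d dvd N" "d dvd n"
    using N by (auto simp: d_def)
  define e where "e = N div d"
  have Ne: "N = e * d" and e: "e > 0"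
    using d N by (auto simp: e_def)
  have cop: "coprime e (n div d)"
    unfolding e_def d_def using N by (metis coprime_commute div_gcd_coprime less_irrefl)
  have dvd: "N dvd i * n \<longleftrightarrow> e dvd i" for i
  proof -
    have "N dvd i * n \<longleftrightarrow> e * d dvd (i * (n div d)) * d"
      using d by (simp add: Ne mult.assoc)
    also have "\<dots> \<longleftrightarrow> e dvd i * (n div d)"
      using d by simp
    also have "\<dots> \<longleftrightarrow> e dvd i"
      using cop by (simp add: coprime_dvd_mult_left_iff)
    finally show ?thesis .
  qed
  have "{0..ord g - 1} = {..<N}"
    using N ordN by auto
  then have inj: "inj_on (\<lambda>i. g [^] i) {..<N}" and car: "carrier G = (\<lambda>i. g [^] i) ` {..<N}"
    using ord_inj[OF g] ord_elems[OF fin g] gen by auto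
  have "{x \<in> carrier G. x [^] n = \<one>} = (\<lambda>i. g [^] i) ` {i \<in> {..<N}. e dvd i}"
    using g by (auto simp: car nat_pow_pow pow_eq_id ordN dvd)
  also have "card \<dots> = card {i \<in> {..<N}. e dvd i}"
    by (intro card_image inj_on_subset[OF inj]) auto
  also have "{i \<in> {..<N}. e dvd i} = (\<lambda>k. e * k) ` {..<d}"
    using e by (auto simp: Ne)
  also have "card \<dots> = d"
    using e by (subst card_image) (auto simp: inj_on_def)
  finally show ?thesis
    by (simp add: d_def N_def)
qed

text \<open>Multiplication by one root \<open>y\<close> of \<open>b\<close> carries the roots of \<open>\<one>\<close> onto the roots
  of \<open>b\<close>.\<close>

lemma (in comm_group) card_roots_eq_card_roots_of_one:
  assumes y: "y \<in> carrier G"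
  shows "card {x \<in> carrier G. x [^] (n::nat) = y [^] n} = card {x \<in> carrier G. x [^] n = \<one>}"
proof (rule bij_betw_same_card[symmetric])
  have cancel: "y \<otimes> (inv y \<otimes> x) = x" "inv y \<otimes> (y \<otimes> x) = x" if "x \<in> carrier G" for x
    using that y by (simp_all add: m_assoc[symmetric])
  show "bij_betw (\<lambda>x. y \<otimes> x) {x \<in> carrier G. x [^] n = \<one>}
          {x \<in> carrier G. x [^] n = y [^] n}"
    by (rule bij_betw_byWitness[where f' = "\<lambda>x. inv y \<otimes> x"])
       (use y cancel in \<open>auto simp: pow_mult_distrib m_comm nat_pow_inv\<close>)
qed

lemma (in comm_group) card_powers_mult_card_roots_of_one:
  assumes fin: "finite (carrier G)"
  shows "card ((\<lambda>x. x [^] (n::nat)) ` carrier G) * card {x \<in> carrier G. x [^] n = \<one>} = order G"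
proof -
  let ?f = "\<lambda>x. x [^] n"
  have "order G = (\<Sum>b \<in> ?f ` carrier G. card {x \<in> carrier G. ?f x = b})"
    unfolding order_def using sum.image_gen[OF fin, of "\<lambda>_. 1::nat" ?f] by simp
  also have "\<dots> = (\<Sum>b \<in> ?f ` carrier G. card {x \<in> carrier G. x [^] n = \<one>})"
    by (rule sum.cong) (auto simp: card_roots_eq_card_roots_of_one)
  finally show ?thesis
    by simp
qed

section \<open>Power residues modulo a prime\<close>

context
  fixes p n :: nat
  assumes p: "prime p" and n: "n > 0"
begin

interpretation residues_prime p "Fp p"
  by unfold_locales (use p in simp_all)

interpretation mult: comm_group "mult_of (Fp p)"
  rewrites "([^]\<^bsub>mult_of (Fp p)\<^esub>) = (([^]\<^bsub>Fp p\<^esub>) :: int \<Rightarrow> nat \<Rightarrow> int)"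
    and "\<one>\<^bsub>mult_of (Fp p)\<^esub> = \<one>\<^bsub>Fp p\<^esub>"
    and "carrier (mult_of (Fp p)) = carrier (Fp p) - {\<zero>\<^bsub>Fp p\<^esub>}"
  using units_comm_group by (simp_all add: nat_pow_mult_of flip: mult_of_is_Units)

lemma zero_power: "\<zero>\<^bsub>Fp p\<^esub> [^]\<^bsub>Fp p\<^esub> n = \<zero>\<^bsub>Fp p\<^esub>"
  using n by (simp add: nat_pow_zero)

lemma order_mult_of_Fp: "order (mult_of (Fp p)) = p - 1"
  using order_mult_of[OF finite] p prime_gt_0_nat[OF p] by (simp add: order_def res_carrier_eq)

lemma card_roots_of_one_Fp:
  "card {x \<in> carrier (Fp p) - {\<zero>\<^bsub>Fp p\<^esub>}. x [^]\<^bsub>Fp p\<^esub> n = \<one>\<^bsub>Fp p\<^esub>} = gcd n (p - 1)"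
proof -
  have "finite (carrier (Fp p) - {\<zero>\<^bsub>Fp p\<^esub>})"
    by simp
  moreover obtain g where "g \<in> carrier (Fp p) - {\<zero>\<^bsub>Fp p\<^esub>}"
    "carrier (Fp p) - {\<zero>\<^bsub>Fp p\<^esub>} = {g [^]\<^bsub>Fp p\<^esub> i | i::nat. i \<in> UNIV}"
    using finite_field_mult_group_has_gen[OF finite] unfolding carrier_mult_of by blast
  ultimately show ?thesis
    unfolding order_mult_of_Fp[symmetric] by (rule mult.card_roots_of_one_cyclic)
qed

lemma power_residue_iff:
  "power_residue p n a \<longleftrightarrow> a \<in> (\<lambda>x. x [^]\<^bsub>Fp p\<^esub> n) ` (carrier (Fp p) - {\<zero>\<^bsub>Fp p\<^esub>})"
proof
  show "a \<in> (\<lambda>x. x [^]\<^bsub>Fp p\<^esub> n) ` (carrier (Fp p) - {\<zero>\<^bsub>Fp p\<^esub>})" if "power_residue p n a"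
    using that zero_power unfolding power_residue_def by (metis DiffE DiffI imageI singletonI singletonD)
  show "power_residue p n a" if "a \<in> (\<lambda>x. x [^]\<^bsub>Fp p\<^esub> n) ` (carrier (Fp p) - {\<zero>\<^bsub>Fp p\<^esub>})"
    using that mult.nat_pow_closed[of _ n] unfolding power_residue_def by auto
qed

lemma power_nonresidue_iff:
  assumes "a \<in> carrier (Fp p)"
  shows "power_nonresidue p n a \<longleftrightarrow> \<not> (\<exists>x\<in>carrier (Fp p). x [^]\<^bsub>Fp p\<^esub> n = a)"
  using assms zero_power zero_closed by (auto simp: power_nonresidue_def)

lemma card_roots_of_power_residue:
  assumes "power_residue p n a"
  shows "card {x \<in> carrier (Fp p). x [^]\<^bsub>Fp p\<^esub> n = a} = gcd n (p - 1)"
proof -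
  obtain y where y: "y \<in> carrier (Fp p) - {\<zero>\<^bsub>Fp p\<^esub>}" "a = y [^]\<^bsub>Fp p\<^esub> n"
    using assms by (auto simp: power_residue_iff)
  have "a \<noteq> \<zero>\<^bsub>Fp p\<^esub>"
    using assms by (simp add: power_residue_def)
  then have "{x \<in> carrier (Fp p). x [^]\<^bsub>Fp p\<^esub> n = a}
      = {x \<in> carrier (Fp p) - {\<zero>\<^bsub>Fp p\<^esub>}. x [^]\<^bsub>Fp p\<^esub> n = y [^]\<^bsub>Fp p\<^esub> n}"
    using zero_power y by auto
  then show ?thesis
    using mult.card_roots_eq_card_roots_of_one[OF y(1), of n] card_roots_of_one_Fp by simp
qed

lemma card_power_nonresidues:
  "real (card {a. power_nonresidue p n a}) = real p - 1 - (real p - 1) / real (gcd n (p - 1))"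
proof -
  let ?U = "carrier (Fp p) - {\<zero>\<^bsub>Fp p\<^esub>}"
  let ?I = "(\<lambda>x. x [^]\<^bsub>Fp p\<^esub> n) ` ?U"
  have fin: "finite ?U"
    by simp
  have sub: "?I \<subseteq> ?U"
    using power_residue_iff by (auto simp: power_residue_def)
  have "{a. power_nonresidue p n a} = ?U - ?I"
    by (auto simp: power_residue_iff[symmetric] power_nonresidue_def power_residue_def)
  then have "card {a. power_nonresidue p n a} = card ?U - card ?I"
    by (simp only: card_Diff_subset[OF finite_subset[OF sub fin] sub])
  then have "real (card {a. power_nonresidue p n a}) = real (card ?U) - real (card ?I)"
    using card_mono[OF fin sub] by simp
  moreover have "card ?U = p - 1"
    using order_mult_of_Fp by (simp add: order_def)
  moreover have "card ?I * gcd n (p - 1) = p - 1"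
    using mult.card_powers_mult_card_roots_of_one[OF fin, of n]
    by (simp only: card_roots_of_one_Fp order_mult_of_Fp)
  then have "real (card ?I) = real (p - 1) / real (gcd n (p - 1))"
    using n by (simp add: eq_divide_eq flip: of_nat_mult)
  moreover have "real (p - 1) = real p - 1"
    using prime_gt_0_nat[OF p] by simp
  ultimately show ?thesis
    by simp
qed

section \<open>Periodic points on diagonal lines\<close>

lemma h_closed:
  "c \<in> carrier (Fp p) \<Longrightarrow> x \<in> carrier (Fp p) \<Longrightarrow> h p n c x \<in> carrier (Fp p)"
  unfolding h_def by (rule a_closed[OF nat_pow_closed])

text \<open>On the diagonal \<open>j = i + a\<close> the parameter is determined by the point as \<open>i = j - a\<close>.\<close>

lemma fixed_points_on_diagonal:
  assumes a: "a \<in> carrier (Fp p)"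
  shows "fixed_points_on p (h p n) (diagonal_line p a)
    = (\<lambda>x. (x \<ominus>\<^bsub>Fp p\<^esub> a, x)) ` {x \<in> carrier (Fp p). x [^]\<^bsub>Fp p\<^esub> n = a}"
proof (intro equalityI subsetI)
  fix z assume "z \<in> fixed_points_on p (h p n) (diagonal_line p a)"
  then obtain i where i: "i \<in> carrier (Fp p)" and z: "z = (i, i \<oplus>\<^bsub>Fp p\<^esub> a)"
    and fix_eq: "(i \<oplus>\<^bsub>Fp p\<^esub> a) [^]\<^bsub>Fp p\<^esub> n \<oplus>\<^bsub>Fp p\<^esub> i = i \<oplus>\<^bsub>Fp p\<^esub> a"
    by (auto simp: fixed_points_on_def diagonal_line_def fixed_point_def h_def)
  have "(i \<oplus>\<^bsub>Fp p\<^esub> a) [^]\<^bsub>Fp p\<^esub> n = a"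
    using fix_eq i a add.right_cancel[OF i] by (simp add: a_comm[OF i a])
  moreover have "i = (i \<oplus>\<^bsub>Fp p\<^esub> a) \<ominus>\<^bsub>Fp p\<^esub> a"
    using i a by (simp add: minus_eq a_assoc r_neg)
  ultimately show "z \<in> (\<lambda>x. (x \<ominus>\<^bsub>Fp p\<^esub> a, x)) ` {x \<in> carrier (Fp p). x [^]\<^bsub>Fp p\<^esub> n = a}"
    using i a z by (auto intro!: image_eqI[of _ _ "i \<oplus>\<^bsub>Fp p\<^esub> a"])
next
  fix z assume "z \<in> (\<lambda>x. (x \<ominus>\<^bsub>Fp p\<^esub> a, x)) ` {x \<in> carrier (Fp p). x [^]\<^bsub>Fp p\<^esub> n = a}"
  then obtain x where x: "x \<in> carrier (Fp p)" "x [^]\<^bsub>Fp p\<^esub> n = a"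
    and z: "z = (x \<ominus>\<^bsub>Fp p\<^esub> a, x)"
    by auto
  have "(x \<ominus>\<^bsub>Fp p\<^esub> a) \<oplus>\<^bsub>Fp p\<^esub> a = x"
    using x(1) a by (simp add: minus_eq a_assoc l_neg)
  moreover from this have "h p n (x \<ominus>\<^bsub>Fp p\<^esub> a) x = x"
    using x a by (simp add: h_def a_comm)
  ultimately show "z \<in> fixed_points_on p (h p n) (diagonal_line p a)"
    using x(1) a z by (auto simp: fixed_points_on_def diagonal_line_def fixed_point_def)
qed

text \<open>The point just before a return to \<open>i + a\<close> on the orbit is the desired root.\<close>

lemma periodic_point_imp_root:
  assumes i: "i \<in> carrier (Fp p)" and a: "a \<in> carrier (Fp p)"
    and per: "periodic_point p (h p n i) (i \<oplus>\<^bsub>Fp p\<^esub> a)"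
  shows "\<exists>y\<in>carrier (Fp p). y [^]\<^bsub>Fp p\<^esub> n = a"
proof -
  obtain r where r: "r \<ge> 1" "(h p n i ^^ r) (i \<oplus>\<^bsub>Fp p\<^esub> a) = i \<oplus>\<^bsub>Fp p\<^esub> a"
    using per by (auto simp: periodic_point_def)
  define y where "y = (h p n i ^^ (r - 1)) (i \<oplus>\<^bsub>Fp p\<^esub> a)"
  have "(h p n i ^^ k) (i \<oplus>\<^bsub>Fp p\<^esub> a) \<in> carrier (Fp p)" for k
    by (induction k) (use i a h_closed in auto)
  then have y: "y \<in> carrier (Fp p)"
    by (simp add: y_def)
  have "h p n i y = i \<oplus>\<^bsub>Fp p\<^esub> a"
    using r by (cases r) (auto simp: y_def)
  then have "y [^]\<^bsub>Fp p\<^esub> n \<oplus>\<^bsub>Fp p\<^esub> i = a \<oplus>\<^bsub>Fp p\<^esub> i"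
    by (simp add: h_def a_comm[OF i a])
  then have "y [^]\<^bsub>Fp p\<^esub> n = a"
    using add.right_cancel[OF i] y a by simp
  with y show ?thesis
    by blast
qed

lemma diagonal_meets_PPD_iff:
  assumes a: "a \<in> carrier (Fp p)"
  shows "diagonal_line p a \<inter> PPD p (h p n) \<noteq> {}
    \<longleftrightarrow> (\<exists>x\<in>carrier (Fp p). x [^]\<^bsub>Fp p\<^esub> n = a)"
proof
  assume "diagonal_line p a \<inter> PPD p (h p n) \<noteq> {}"
  then show "\<exists>x\<in>carrier (Fp p). x [^]\<^bsub>Fp p\<^esub> n = a"
    using periodic_point_imp_root[OF _ a] by (auto simp: diagonal_line_def PPD_def)
next
  assume "\<exists>x\<in>carrier (Fp p). x [^]\<^bsub>Fp p\<^esub> n = a"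
  then obtain x where x: "x \<in> carrier (Fp p)" "x [^]\<^bsub>Fp p\<^esub> n = a"
    by blast
  then have "(x \<ominus>\<^bsub>Fp p\<^esub> a, x) \<in> fixed_points_on p (h p n) (diagonal_line p a)"
    using fixed_points_on_diagonal[OF a] by blast
  then have line: "(x \<ominus>\<^bsub>Fp p\<^esub> a, x) \<in> diagonal_line p a"
    and fixed: "h p n (x \<ominus>\<^bsub>Fp p\<^esub> a) x = x"
    by (auto simp: fixed_points_on_def fixed_point_def)
  have "periodic_point p (h p n (x \<ominus>\<^bsub>Fp p\<^esub> a)) x"
    unfolding periodic_point_def using x(1) fixed by (auto intro: exI[of _ 1])
  then have "(x \<ominus>\<^bsub>Fp p\<^esub> a, x) \<in> PPD p (h p n)"
    using x(1) a by (simp add: PPD_def)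
  with line show "diagonal_line p a \<inter> PPD p (h p n) \<noteq> {}"
    by blast
qed

lemma desert_line_iff:
  assumes "a \<in> carrier (Fp p)"
  shows "desert_line p (h p n) (diagonal_line p a) \<longleftrightarrow> power_nonresidue p n a"
  using diagonal_meets_PPD_iff[OF assms] power_nonresidue_iff[OF assms] assms
  by (auto simp: desert_line_def)

text \<open>The offset of a line is recovered from its position over the parameter \<open>0\<close>, so counting
  desert lines amounts to counting their offsets.\<close>

lemma inj_on_diagonal_line: "inj_on (diagonal_line p) (carrier (Fp p))"
proof (rule inj_onI)
  fix a b assume ab: "a \<in> carrier (Fp p)" "b \<in> carrier (Fp p)"
    and eq: "diagonal_line p a = diagonal_line p b"
  have "(\<zero>\<^bsub>Fp p\<^esub>, a) \<in> diagonal_line p a"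
    unfolding diagonal_line_def using ab(1) l_zero zero_closed by fastforce
  then have "(\<zero>\<^bsub>Fp p\<^esub>, a) \<in> diagonal_line p b"
    by (simp only: eq)
  then have "a = \<zero>\<^bsub>Fp p\<^esub> \<oplus>\<^bsub>Fp p\<^esub> b"
    unfolding diagonal_line_def by blast
  then show "a = b"
    using l_zero[OF ab(2)] by (simp only:)
qed

lemma card_desert_lines:
  "card {L. desert_line p (h p n) L} = card {a. power_nonresidue p n a}"
proof -
  have sub: "{a. power_nonresidue p n a} \<subseteq> carrier (Fp p)"
    by (auto simp: power_nonresidue_def)
  have "{L. desert_line p (h p n) L} = diagonal_line p ` {a. power_nonresidue p n a}"
  proof (intro equalityI subsetI)
    fix L assume L: "L \<in> {L. desert_line p (h p n) L}"
    then obtain a where "a \<in> carrier (Fp p)" "L = diagonal_line p a"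
      by (auto simp: desert_line_def)
    then show "L \<in> diagonal_line p ` {a. power_nonresidue p n a}"
      using L desert_line_iff by auto
  next
    fix L assume "L \<in> diagonal_line p ` {a. power_nonresidue p n a}"
    then show "L \<in> {L. desert_line p (h p n) L}"
      using desert_line_iff sub by auto
  qed
  then show ?thesis
    using card_image[OF inj_on_subset[OF inj_on_diagonal_line sub]] by simp
qed

lemma card_fixed_points_on_diagonal:
  assumes "power_residue p n a"
  shows "card (fixed_points_on p (h p n) (diagonal_line p a)) = gcd (p - 1) n"
proof -
  have a: "a \<in> carrier (Fp p)"
    using assms by (simp add: power_residue_def)
  have "inj_on (\<lambda>x. (x \<ominus>\<^bsub>Fp p\<^esub> a, x)) {x \<in> carrier (Fp p). x [^]\<^bsub>Fp p\<^esub> n = a}"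
    by (auto simp: inj_on_def)
  then show ?thesis
    using card_roots_of_power_residue[OF assms]
    by (simp add: fixed_points_on_diagonal[OF a] card_image gcd.commute)
qed

text \<open>A field has no nilpotent elements, so \<open>0\<close> is the only \<open>n\<close>-th root of \<open>0\<close>.\<close>

lemma fixed_points_on_main_diagonal:
  "fixed_points_on p (h p n) (diagonal_line p \<zero>\<^bsub>Fp p\<^esub>) = {(\<zero>\<^bsub>Fp p\<^esub>, \<zero>\<^bsub>Fp p\<^esub>)}"
proof -
  have "{x \<in> carrier (Fp p). x [^]\<^bsub>Fp p\<^esub> n = \<zero>\<^bsub>Fp p\<^esub>} = {\<zero>\<^bsub>Fp p\<^esub>}"
    using mult.nat_pow_closed[of _ n] zero_power zero_closed by blast
  moreover have "\<zero>\<^bsub>Fp p\<^esub> \<ominus>\<^bsub>Fp p\<^esub> \<zero>\<^bsub>Fp p\<^esub> = \<zero>\<^bsub>Fp p\<^esub>"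
    using zero_closed by simp
  ultimately show ?thesis
    by (simp only: fixed_points_on_diagonal[OF zero_closed] image_insert image_empty)
qed

end

section \<open>Desert lines and fixed points\<close>

theorem theorem4p3:
  fixes p n :: nat
  assumes "prime p" and "n \<ge> 2"
  shows "(\<forall>a\<in>carrier (Fp p).
            desert_line p (h p n) (diagonal_line p a) \<longleftrightarrow> power_nonresidue p n a) \<and>
         real (card {L. desert_line p (h p n) L}) =
            real p - 1 - (real p - 1) / real (gcd n (p - 1)) \<and>
         (\<forall>a\<in>carrier (Fp p). power_residue p n a \<longrightarrow>
            card (fixed_points_on p (h p n) (diagonal_line p a)) = gcd (p - 1) n) \<and>
         fixed_points_on p (h p n) (diagonal_line p \<zero>\<^bsub>Fp p\<^esub>) = {(\<zero>\<^bsub>Fp p\<^esub>, \<zero>\<^bsub>Fp p\<^esub>)}"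
proof -
  have n: "n > 0"
    using assms(2) by simp
  show ?thesis
    using desert_line_iff[OF assms(1) n] card_desert_lines[OF assms(1) n]
      card_power_nonresidues[OF assms(1) n] card_fixed_points_on_diagonal[OF assms(1) n]
      fixed_points_on_main_diagonal[OF assms(1) n]
    by simp
qed

end
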